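(* Let $G$ be a connected undirected graph with $N_0$ vertices and $E_0$ edges. For $n\ge 2$ let $\tau_n(G)$ be the $n$-polygon graph of $G$, and for $g\ge 1$ let $\tau_n^g(G)$ be the iterated $n$-polygon graph of $G$ with generation $g$. Let $N_{st}(\cdot)$ denote the number of spanning trees. Then for $n\ge 2$, $$N_{st}(\tau_n(G))=(n+1)^{N_0-1}\,n^{E_0-N_0+1}\,N_{st}(G),$$ and for $n\ge 2$ and $g\ge 1$, $$N_{st}(\tau_n^g(G))=(n+1)^{\frac{(n-1)\left[(n+1)^g-ng-1\right]}{n^2}E_0+gN_0-g}\cdot n^{\frac{(n+1)^g+(n-1)ng-1}{n^2}E_0-gN_0+g}\cdot N_{st}(G).$$
   Context: Graphs are finite, simple and undirected. For $n\ge 2$, the $n$-polygon graph $\tau_n(G)$ is obtained from $G$ by adding, for each edge $ij$ of $G$, a new path of length $n$ (with $n-1$ new internal vertices) joining $i$ and $j$, while keeping the edge $ij$. The iterated graphs are $\tau_n^0(G)=G$ and $\tau_n^g(G)=\tau_n(\tau_n^{g-1}(G))$ for $g\ge 1$. *)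

theory Defs
  imports Complex_Main
begin

record 'a ugraph =
  verts :: "'a set"
  edges :: "'a set set"

text \<open>Edges are two-element vertex sets, which rules out loops, multiple edges and directions.\<close>

definition simple_graph :: "'a ugraph \<Rightarrow> bool" where
  "simple_graph G \<longleftrightarrow> finite (verts G) \<and> (\<forall>e \<in> edges G. e \<subseteq> verts G \<and> card e = 2)"

definition path_edges :: "'a list \<Rightarrow> 'a set set" where
  "path_edges xs = {{xs ! i, xs ! Suc i} | i. Suc i < length xs}"

definition walk :: "'a ugraph \<Rightarrow> 'a list \<Rightarrow> bool" where
  "walk G xs \<longleftrightarrow> xs \<noteq> [] \<and> set xs \<subseteq> verts G \<and> path_edges xs \<subseteq> edges G"

text \<open>A connected graph is nonempty by convention.\<close>

definition connected_graph :: "'a ugraph \<Rightarrow> bool" where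
  "connected_graph G \<longleftrightarrow> verts G \<noteq> {} \<and>
     (\<forall>u \<in> verts G. \<forall>v \<in> verts G. \<exists>xs. walk G xs \<and> hd xs = u \<and> last xs = v)"

text \<open>A cycle is given by its distinct vertices in cyclic order, the first one not repeated.\<close>

definition cycle :: "'a ugraph \<Rightarrow> 'a list \<Rightarrow> bool" where
  "cycle G xs \<longleftrightarrow> length xs \<ge> 3 \<and> distinct xs \<and> walk G (xs @ [hd xs])"

definition tree :: "'a ugraph \<Rightarrow> bool" where
  "tree T \<longleftrightarrow> connected_graph T \<and> (\<nexists>xs. cycle T xs)"

definition spanning_tree :: "'a ugraph \<Rightarrow> 'a ugraph \<Rightarrow> bool" where
  "spanning_tree G T \<longleftrightarrow> verts T = verts G \<and> edges T \<subseteq> edges G \<and> tree T"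

definition N_st :: "'a ugraph \<Rightarrow> nat" where
  "N_st G = card {T. spanning_tree G T}"

definition inner_verts :: "'a list \<Rightarrow> 'a set" where
  "inner_verts xs = set (butlast (tl xs))"

text \<open>
  The \<open>n\<close>-polygon graph is determined only up to the names of the new vertices, so it is
  a relation: \<open>polygon_graph n G H\<close> says that \<open>H\<close> is an \<open>n\<close>-polygon graph of \<open>G\<close>.
  The list \<open>P e\<close> consists of the \<open>n + 1\<close> vertices of the path of length \<open>n\<close> attached to the
  edge \<open>e\<close>.
\<close>

definition polygon_graph :: "nat \<Rightarrow> 'a ugraph \<Rightarrow> 'a ugraph \<Rightarrow> bool" where
  "polygon_graph n G H \<longleftrightarrow> (\<exists>P.
     (\<forall>e \<in> edges G. length (P e) = n + 1 \<and> distinct (P e) \<and> {hd (P e), last (P e)} = e \<and>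
        inner_verts (P e) \<inter> verts G = {}) \<and>
     (\<forall>e \<in> edges G. \<forall>f \<in> edges G. e \<noteq> f \<longrightarrow> inner_verts (P e) \<inter> inner_verts (P f) = {}) \<and>
     verts H = verts G \<union> (\<Union>e \<in> edges G. inner_verts (P e)) \<and>
     edges H = edges G \<union> (\<Union>e \<in> edges G. path_edges (P e)))"

definition iterated_polygon_graph :: "nat \<Rightarrow> nat \<Rightarrow> 'a ugraph \<Rightarrow> 'a ugraph \<Rightarrow> bool" where
  "iterated_polygon_graph n g = (polygon_graph n ^^ g)"

text \<open>
  The remaining lemmas show that these relations are not vacuous: over an infinite vertex type
  every finite simple graph has iterated \<open>n\<close>-polygon graphs of each generation.
\<close>

lemma set_list_inner_verts:
  assumes "length xs \<ge> 2"
  shows "set xs = {hd xs, last xs} \<union> inner_verts xs"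
proof -
  obtain a ys where xs: "xs = a # ys" "ys \<noteq> []"
    using assms by (cases xs; cases "tl xs") auto
  then have "set ys = set (butlast ys) \<union> {last ys}"
    by (metis append_butlast_last_id list.set(1,2) set_append)
  with xs show ?thesis by (auto simp: inner_verts_def)
qed

lemma simple_graph_polygon_graph:
  assumes G: "simple_graph G" and n: "n \<ge> 2" and H: "polygon_graph n G H"
  shows "simple_graph H"
proof -
  obtain P where P: "\<forall>e \<in> edges G. length (P e) = n + 1 \<and> distinct (P e) \<and>
        {hd (P e), last (P e)} = e \<and> inner_verts (P e) \<inter> verts G = {}"
    and V: "verts H = verts G \<union> (\<Union>e \<in> edges G. inner_verts (P e))"
    and E: "edges H = edges G \<union> (\<Union>e \<in> edges G. path_edges (P e))"
    using H unfolding polygon_graph_def by auto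
  have "edges G \<subseteq> Pow (verts G)" "finite (verts G)"
    using G by (auto simp: simple_graph_def)
  then have fin: "finite (edges G)" by (meson finite_Pow_iff finite_subset)
  have "d \<subseteq> verts H \<and> card d = 2" if d: "d \<in> edges H" for d
  proof (cases "d \<in> edges G")
    case True
    then show ?thesis using G V by (auto simp: simple_graph_def)
  next
    case False
    then obtain e where e: "e \<in> edges G" "d \<in> path_edges (P e)" using d E by auto
    then obtain i where i: "Suc i < length (P e)" "d = {P e ! i, P e ! Suc i}"
      by (auto simp: path_edges_def)
    have "distinct (P e)" "length (P e) \<ge> 2" using P e n by auto
    then have "card d = 2" using i by (simp add: nth_eq_iff_index_eq)
    moreover have "set (P e) = e \<union> inner_verts (P e)"
      using set_list_inner_verts[OF \<open>length (P e) \<ge> 2\<close>] P e by auto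
    then have "set (P e) \<subseteq> verts H" using V e G by (auto simp: simple_graph_def)
    then have "d \<subseteq> verts H" using i by (auto simp: subset_iff)
    ultimately show ?thesis by simp
  qed
  moreover have "finite (verts H)"
    using V fin \<open>finite (verts G)\<close> by (auto simp: inner_verts_def)
  ultimately show ?thesis by (simp add: simple_graph_def)
qed

lemma polygon_graph_exists:
  fixes G :: "'a ugraph"
  assumes G: "simple_graph G" and n: "n \<ge> 2" and inf: "infinite (UNIV :: 'a set)"
  shows "\<exists>H. polygon_graph n G H"
proof -
  let ?A = "edges G \<times> {..<n - 1}"
  have "edges G \<subseteq> Pow (verts G)" and fV: "finite (verts G)"
    using G by (auto simp: simple_graph_def)
  then have "finite (edges G)" by (meson finite_Pow_iff finite_subset)
  then have fA: "finite ?A" by simp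
  have "infinite (- verts G)" using inf fV by (metis Compl_eq_Diff_UNIV finite_Diff2)
  then obtain B where B: "finite B" "card B = card ?A" "B \<subseteq> - verts G"
    using infinite_arbitrarily_large by blast
  obtain h where h: "bij_betw h ?A B" using finite_same_card_bij[OF fA B(1)] B(2) by auto
  have "\<forall>e \<in> edges G. \<exists>p. e = {fst p, snd p} \<and> fst p \<noteq> snd p"
    using G by (force simp: simple_graph_def card_2_iff)
  then obtain r where r: "\<And>e. e \<in> edges G \<Longrightarrow> e = {fst (r e), snd (r e)} \<and> fst (r e) \<noteq> snd (r e)"
    by metis
  define P where "P e = fst (r e) # map (\<lambda>k. h (e, k)) [0..<n - 1] @ [snd (r e)]" for e
  have inner: "inner_verts (P e) = (\<lambda>k. h (e, k)) ` {..<n - 1}" for e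
    by (auto simp: inner_verts_def P_def)
  have out: "inner_verts (P e) \<inter> verts G = {}" if "e \<in> edges G" for e
    using h B(3) that unfolding inner bij_betw_def by blast
  have "length (P e) = n + 1 \<and> distinct (P e) \<and> {hd (P e), last (P e)} = e"
    if e: "e \<in> edges G" for e
  proof -
    have "inj_on (\<lambda>k. h (e, k)) {0..<n - 1}"
      using h e by (auto simp: bij_betw_def inj_on_def)
    moreover have "{fst (r e), snd (r e)} \<subseteq> verts G"
      using r[OF e] G e by (auto simp: simple_graph_def)
    then have "fst (r e) \<notin> inner_verts (P e)" "snd (r e) \<notin> inner_verts (P e)"
      using out[OF e] by auto
    ultimately have "distinct (P e)"
      using r[OF e] unfolding inner by (auto simp: P_def distinct_map)
    then show ?thesis using n r[OF e] by (simp add: P_def)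
  qed
  moreover have "inner_verts (P e) \<inter> inner_verts (P f) = {}"
    if "e \<in> edges G" "f \<in> edges G" "e \<noteq> f" for e f
    using h that unfolding inner bij_betw_def inj_on_def by auto
  ultimately have "polygon_graph n G
      \<lparr>verts = verts G \<union> (\<Union>e \<in> edges G. inner_verts (P e)),
       edges = edges G \<union> (\<Union>e \<in> edges G. path_edges (P e))\<rparr>"
    unfolding polygon_graph_def using out by (intro exI[of _ P]) auto
  then show ?thesis ..
qed

lemma iterated_polygon_graph_exists:
  fixes G :: "'a ugraph"
  assumes "simple_graph G" "n \<ge> 2" "infinite (UNIV :: 'a set)"
  shows "\<exists>H. iterated_polygon_graph n g G H \<and> simple_graph H"
proof (induction g)
  case 0
  then show ?case using assms by (auto simp: iterated_polygon_graph_def)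
next
  case (Suc g)
  then obtain K where "iterated_polygon_graph n g G K" "simple_graph K" by auto
  moreover obtain H where "polygon_graph n K H"
    using polygon_graph_exists \<open>simple_graph K\<close> assms by blast
  ultimately show ?case
    using simple_graph_polygon_graph assms by (auto simp: iterated_polygon_graph_def)
qed

end

theory Submission
  imports Defs "HOL-Library.FuncSet"
begin

text \<open>
  Each edge \<open>e\<close> of \<open>G\<close> together with its new path forms a cycle of length \<open>n + 1\<close> in the polygon
  graph \<open>H\<close>. These cycles share no edge, and they meet only in vertices of \<open>G\<close>. A spanning tree
  \<open>F\<close> of \<open>H\<close> meets the cycle of \<open>e\<close> in one of two ways: either exactly one of the \<open>n + 1\<close> cycle
  edges is absent, and then \<open>F\<close> joins the ends of \<open>e\<close> inside the cycle; or \<open>e\<close> itself and exactly one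
  of the \<open>n\<close> path edges are absent, and then it does not. Any other pattern leaves a closed
  cycle or cuts off an inner vertex. Let the \<^emph>\<open>shadow\<close> of \<open>F\<close> be the set of edges
  of \<open>G\<close> whose ends are joined by \<open>F\<close> inside their cycle. The shadow is a spanning tree \<open>T\<close> of \<open>G\<close>,
  and conversely every spanning tree \<open>T\<close> of \<open>G\<close> can be refined independently in each cycle, with
  \<open>n + 1\<close> options for each edge in \<open>T\<close> and \<open>n\<close> options for each edge outside. As \<open>T\<close> has
  \<open>N\<^sub>0 - 1\<close> edges, each \<open>T\<close> accounts for \<open>(n + 1)^(N\<^sub>0 - 1) n^(E\<^sub>0 - N\<^sub>0 + 1)\<close> spanning trees of \<open>H\<close>.
  The bijection between the sets \<open>F\<close> and the pairs of a tree and a family of options is the content of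
  \<open>cut_open_in_spanning_tree_edges\<close>, \<open>cut_open_inj\<close> and \<open>cut_open_surj\<close>.

  To avoid manipulating walks, connectedness is expressed by cuts: a set of edges connects \<open>V\<close> iff
  no vertex set that it does not cross splits \<open>V\<close>. Spanning trees are then the minimal connecting edge
  sets (\<open>N_st_eq_card_spanning_tree_edges\<close>), and comparing \<open>F\<close> with its shadow means extending or
  restricting vertex sets between \<open>G\<close> and \<open>H\<close> (\<open>connects_iff\<close>).

  The formula for \<open>g\<close> generations follows by induction on \<open>g\<close>. Splitting off the first generation
  rather than the last means that only the vertex and edge numbers of \<open>\<tau>\<^sub>n(G)\<close> itself are needed.
\<close>

section \<open>Spanning trees as minimal connecting edge sets\<close>

definition uncut :: "'a set \<Rightarrow> 'a set set \<Rightarrow> bool" where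
  "uncut S F \<longleftrightarrow> (\<forall>e \<in> F. e \<subseteq> S \<or> e \<inter> S = {})"

definition connects :: "'a set set \<Rightarrow> 'a set \<Rightarrow> bool" where
  "connects F V \<longleftrightarrow> (\<forall>S. uncut S F \<longrightarrow> V \<subseteq> S \<or> V \<inter> S = {})"

definition spanning_tree_edges :: "'a set \<Rightarrow> 'a set set \<Rightarrow> 'a set set set" where
  "spanning_tree_edges V E = {F. F \<subseteq> E \<and> connects F V \<and> (\<forall>e \<in> F. \<not> connects (F - {e}) V)}"

lemma connectsD:
  assumes "connects F V" "uncut S F" "u \<in> V" "v \<in> V"
  shows "u \<in> S \<longleftrightarrow> v \<in> S"
proof -
  have "V \<subseteq> S \<or> V \<inter> S = {}" using assms(1,2) by (simp add: connects_def)
  then show ?thesis using assms(3,4) by blast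
qed

lemma uncut_pair: "uncut S F \<Longrightarrow> {u, v} \<in> F \<Longrightarrow> u \<in> S \<longleftrightarrow> v \<in> S"
  by (auto simp: uncut_def)

lemma uncut_mono: "uncut S F \<Longrightarrow> F' \<subseteq> F \<Longrightarrow> uncut S F'"
  by (auto simp: uncut_def)

lemma uncut_list:
  assumes "uncut S (path_edges xs)" "xs \<noteq> []"
  shows "hd xs \<in> S \<longleftrightarrow> last xs \<in> S"
proof -
  have "xs ! 0 \<in> S \<longleftrightarrow> xs ! k \<in> S" if "k < length xs" for k
    using that
  proof (induction k)
    case (Suc k)
    then have "{xs ! k, xs ! Suc k} \<in> path_edges xs" by (auto simp: path_edges_def)
    then show ?case using Suc uncut_pair[OF assms(1)] by auto
  qed simp
  then show ?thesis using assms(2) by (simp add: hd_conv_nth last_conv_nth)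
qed

lemma path_edges_append_subset: "path_edges xs \<subseteq> path_edges (xs @ ys)"
proof
  fix e assume "e \<in> path_edges xs"
  then obtain i where i: "Suc i < length xs" "e = {xs ! i, xs ! Suc i}"
    by (auto simp: path_edges_def)
  then have "e = {(xs @ ys) ! i, (xs @ ys) ! Suc i}" "Suc i < length (xs @ ys)"
    by (auto simp: nth_append)
  then show "e \<in> path_edges (xs @ ys)"
    unfolding path_edges_def by (intro CollectI exI[of _ i] conjI)
qed

lemma path_edges_snoc:
  assumes "xs \<noteq> []"
  shows "path_edges (xs @ [v]) = insert {last xs, v} (path_edges xs)"
proof
  show "path_edges (xs @ [v]) \<subseteq> insert {last xs, v} (path_edges xs)"
  proof
    fix e assume "e \<in> path_edges (xs @ [v])"
    then obtain i where i: "Suc i < length (xs @ [v])"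
      "e = {(xs @ [v]) ! i, (xs @ [v]) ! Suc i}" by (auto simp: path_edges_def)
    show "e \<in> insert {last xs, v} (path_edges xs)"
    proof (cases "Suc i < length xs")
      case True
      then show ?thesis using i by (auto simp: path_edges_def nth_append)
    next
      case False
      then have "i = length xs - 1" "Suc i = length xs" using i by auto
      then show ?thesis using i assms by (auto simp: nth_append last_conv_nth)
    qed
  qed
  have "{last xs, v} \<in> path_edges (xs @ [v])"
    using assms unfolding path_edges_def
    by (auto simp: nth_append last_conv_nth intro!: exI[of _ "length xs - 1"])
  then show "insert {last xs, v} (path_edges xs) \<subseteq> path_edges (xs @ [v])"
    using path_edges_append_subset by blast
qed

text \<open>
  The vertices reachable from \<open>u\<close> by a distinct walk form a set that no edge crosses: when an edge
  leads back to a vertex already visited, the walk is truncated there instead of extended. Working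
  with distinct walks from the start serves both connectedness and the construction of cycles.
\<close>

lemma connects_imp_distinct_walk:
  assumes "connects (edges T) (verts T)" "\<forall>e \<in> edges T. e \<subseteq> verts T \<and> card e = 2"
    and uv: "u \<in> verts T" "v \<in> verts T"
  shows "\<exists>xs. walk T xs \<and> distinct xs \<and> hd xs = u \<and> last xs = v"
proof -
  define S where "S = {v. \<exists>xs. walk T xs \<and> distinct xs \<and> hd xs = u \<and> last xs = v}"
  have step: "w \<in> S" if "x \<in> S" "{x, w} \<in> edges T" for x w
  proof -
    have "\<exists>xs. walk T xs \<and> distinct xs \<and> hd xs = u \<and> last xs = x"
      using that(1) by (simp add: S_def)
    then obtain xs where xs: "walk T xs" "distinct xs" "hd xs = u" "last xs = x" by blast
    show ?thesis
    proof (cases "w \<in> set xs")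
      case True
      then obtain as bs where ab: "xs = (as @ [w]) @ bs" using split_list by fastforce
      have "walk T (as @ [w])"
        using xs(1) path_edges_append_subset[of "as @ [w]" bs]
        unfolding walk_def ab by auto
      moreover have "hd (as @ [w]) = u" using xs(3) ab by (cases as) auto
      ultimately show ?thesis using xs(2) ab unfolding S_def
        by (auto intro!: exI[of _ "as @ [w]"])
    next
      case False
      have "xs \<noteq> []" using xs by (simp add: walk_def)
      then have "walk T (xs @ [w])"
        using xs that(2) assms(2) by (auto simp: walk_def path_edges_snoc)
      then show ?thesis using xs False \<open>xs \<noteq> []\<close> unfolding S_def
        by (auto intro!: exI[of _ "xs @ [w]"])
    qed
  qed
  have "uncut S (edges T)"
    unfolding uncut_def
  proof
    fix e assume e: "e \<in> edges T"
    then obtain x y where xy: "e = {x, y}" using assms(2) by (meson card_2_iff)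
    then have "{y, x} \<in> edges T" using e by (simp add: insert_commute)
    then show "e \<subseteq> S \<or> e \<inter> S = {}" using xy step e by blast
  qed
  moreover have "walk T [u]" using uv by (auto simp: walk_def path_edges_def)
  then have "u \<in> S" unfolding S_def by (auto intro!: exI[of _ "[u]"])
  ultimately have "v \<in> S" using connectsD assms by metis
  then show ?thesis by (simp add: S_def)
qed

lemma connected_graph_iff_connects:
  assumes "\<forall>e \<in> edges T. e \<subseteq> verts T \<and> card e = 2"
  shows "connected_graph T \<longleftrightarrow> verts T \<noteq> {} \<and> connects (edges T) (verts T)"
proof
  assume T: "connected_graph T"
  have "u \<in> S \<longleftrightarrow> v \<in> S" if S: "uncut S (edges T)" and uv: "u \<in> verts T" "v \<in> verts T" for S u v
  proof -
    obtain xs where "walk T xs" "hd xs = u" "last xs = v"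
      using T uv unfolding connected_graph_def by blast
    then show ?thesis
      using uncut_list[of S xs] uncut_mono[OF S] by (auto simp: walk_def)
  qed
  then show "verts T \<noteq> {} \<and> connects (edges T) (verts T)"
    using T unfolding connected_graph_def connects_def by blast
next
  assume "verts T \<noteq> {} \<and> connects (edges T) (verts T)"
  then show "connected_graph T"
    using connects_imp_distinct_walk[OF _ assms] unfolding connected_graph_def by meson
qed

text \<open>
  The closing edge of a cycle is redundant because the rest of the cycle joins its ends. Conversely,
  a redundant edge \<open>uv\<close> closes a distinct walk from \<open>u\<close> to \<open>v\<close> that avoids it.
\<close>

lemma cycle_iff_removable_edge:
  assumes simple: "\<forall>e \<in> edges T. e \<subseteq> verts T \<and> card e = 2"
    and conn: "connects (edges T) (verts T)"
  shows "(\<exists>xs. cycle T xs) \<longleftrightarrow> (\<exists>e \<in> edges T. connects (edges T - {e}) (verts T))"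
proof
  assume "\<exists>xs. cycle T xs"
  then obtain xs where xs: "length xs \<ge> 3" "distinct xs" "walk T (xs @ [hd xs])"
    by (auto simp: cycle_def)
  let ?e = "{last xs, hd xs}"
  have ne: "xs \<noteq> []" using xs by auto
  have sub: "insert ?e (path_edges xs) \<subseteq> edges T"
    using xs(3) path_edges_snoc[OF ne] by (simp add: walk_def)
  \<comment> \<open>The closing edge occurs only once since the cycle has at least three vertices.\<close>
  have "?e \<notin> path_edges xs"
  proof
    assume "?e \<in> path_edges xs"
    then obtain i where i: "Suc i < length xs"
      "{xs ! (length xs - 1), xs ! 0} = {xs ! i, xs ! Suc i}"
      using ne by (auto simp: path_edges_def hd_conv_nth last_conv_nth)
    then have "xs ! (length xs - 1) = xs ! Suc i \<and> xs ! 0 = xs ! i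
      \<or> xs ! (length xs - 1) = xs ! i \<and> xs ! 0 = xs ! Suc i"
      by (auto simp: doubleton_eq_iff)
    moreover have "length xs - 1 < length xs" "0 < length xs" "i < length xs" using i by auto
    ultimately show False using i(1) xs(1,2) by (auto simp: nth_eq_iff_index_eq)
  qed
  then have sub': "path_edges xs \<subseteq> edges T - {?e}" using sub by blast
  have "connects (edges T - {?e}) (verts T)"
    unfolding connects_def
  proof (intro allI impI)
    fix S assume S: "uncut S (edges T - {?e})"
    then have "hd xs \<in> S \<longleftrightarrow> last xs \<in> S" using uncut_list[OF uncut_mono[OF S sub'] ne] by simp
    then have "uncut S (edges T)" using S by (auto simp: uncut_def)
    then show "verts T \<subseteq> S \<or> verts T \<inter> S = {}" using conn by (simp add: connects_def)
  qed
  then show "\<exists>e \<in> edges T. connects (edges T - {e}) (verts T)" using sub by blast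
next
  assume "\<exists>e \<in> edges T. connects (edges T - {e}) (verts T)"
  then obtain e where e: "e \<in> edges T" "connects (edges T - {e}) (verts T)" by blast
  obtain u v where uv: "e = {u, v}" "u \<noteq> v" using simple e by (meson card_2_iff)
  let ?T = "\<lparr>verts = verts T, edges = edges T - {e}\<rparr>"
  have "u \<in> verts T" "v \<in> verts T" using simple e(1) uv(1) by auto
  then have "\<exists>xs. walk ?T xs \<and> distinct xs \<and> hd xs = u \<and> last xs = v"
    using e(2) simple by (intro connects_imp_distinct_walk) auto
  then obtain xs where xs: "walk ?T xs" "distinct xs" "hd xs = u" "last xs = v" by blast
  have ne: "xs \<noteq> []" using xs by (simp add: walk_def)
  have pe: "path_edges (xs @ [hd xs]) \<subseteq> edges T"
    using xs e(1) uv path_edges_snoc[OF ne] by (auto simp: walk_def insert_commute)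
  have "length xs \<noteq> 1" using xs(3,4) uv(2) by (auto simp: length_Suc_conv)
  moreover have "length xs \<noteq> 2"
  proof
    assume "length xs = 2"
    then have "xs = [u, v]" using xs(3,4) by (auto simp: length_Suc_conv numeral_2_eq_2)
    then have "e \<in> path_edges xs" using uv by (auto simp: path_edges_def)
    then show False using xs(1) by (auto simp: walk_def)
  qed
  moreover have "length xs \<noteq> 0" using ne by simp
  ultimately have "length xs \<ge> 3" by linarith
  then have "cycle T xs" using xs pe ne by (auto simp: cycle_def walk_def)
  then show "\<exists>xs. cycle T xs" ..
qed

lemma N_st_eq_card_spanning_tree_edges:
  assumes G: "simple_graph G" and ne: "verts G \<noteq> {}"
  shows "N_st G = card (spanning_tree_edges (verts G) (edges G))"
proof -
  have "spanning_tree G T \<longleftrightarrow> verts T = verts G \<and> edges T \<in> spanning_tree_edges (verts G) (edges G)"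
    for T :: "'a ugraph"
  proof (cases "verts T = verts G \<and> edges T \<subseteq> edges G")
    case True
    then have *: "\<forall>e \<in> edges T. e \<subseteq> verts T \<and> card e = 2" using G by (auto simp: simple_graph_def)
    then show ?thesis
      using True ne connected_graph_iff_connects[OF *] cycle_iff_removable_edge[OF *]
      by (auto simp: spanning_tree_def tree_def spanning_tree_edges_def)
  qed (auto simp: spanning_tree_def spanning_tree_edges_def)
  then have "bij_betw edges {T. spanning_tree G T} (spanning_tree_edges (verts G) (edges G))"
    by (intro bij_betw_byWitness[where f' = "\<lambda>F. \<lparr>verts = verts G, edges = F\<rparr>"]) auto
  then show ?thesis unfolding N_st_def by (rule bij_betw_same_card)
qed

text \<open>
  Prim's algorithm: while the vertex set \<open>W\<close> reached so far is not all of \<open>V\<close>, some edge of \<open>F\<close>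
  crosses it, and adding that edge enlarges \<open>W\<close> by one vertex.
\<close>

lemma connecting_subset_of_size:
  assumes "connects F V" "\<forall>e \<in> F. e \<subseteq> V \<and> card e = 2" "finite V" "Suc k \<le> card V"
  shows "\<exists>W F'. W \<subseteq> V \<and> card W = Suc k \<and> F' \<subseteq> F \<and> finite F' \<and> card F' = k \<and>
    F' \<subseteq> Pow W \<and> connects F' W"
  using assms(4)
proof (induction k)
  case 0
  then obtain v where "v \<in> V" by (metis One_nat_def card.empty not_one_le_zero ex_in_conv)
  then show ?case by (intro exI[of _ "{v}"] exI[of _ "{}"]) (auto simp: connects_def)
next
  case (Suc k)
  then obtain W F' where W: "W \<subseteq> V" "card W = Suc k" "F' \<subseteq> F" "finite F'" "card F' = k"
    "F' \<subseteq> Pow W" "connects F' W" by auto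
  have "W \<noteq> V" using W(2) Suc.prems by auto
  moreover have "W \<noteq> {}" using W(2) by auto
  ultimately have "\<not> uncut W F" using assms(1) W(1) unfolding connects_def by blast
  then obtain e where e: "e \<in> F" "\<not> e \<subseteq> W" "e \<inter> W \<noteq> {}" unfolding uncut_def by blast
  obtain u v where uv: "e = {u, v}" "u \<in> W" "v \<notin> W"
    using e assms(2) by (metis (no_types, lifting) card_2_iff disjoint_insert(2) empty_subsetI
        insert_commute insert_subset inf_bot_left inf_commute)
  have "finite W" using W(1) assms(3) finite_subset by blast
  have "connects (insert e F') (insert v W)"
    unfolding connects_def
  proof (intro allI impI)
    fix S assume S: "uncut S (insert e F')"
    then have "W \<subseteq> S \<or> W \<inter> S = {}" using W(7) unfolding connects_def uncut_def by blast
    moreover have "u \<in> S \<longleftrightarrow> v \<in> S" using S uv(1) by (auto simp: uncut_def)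
    ultimately show "insert v W \<subseteq> S \<or> insert v W \<inter> S = {}" using uv(2) by blast
  qed
  moreover have "e \<notin> F'" using e(2) W(6) by blast
  moreover have "v \<in> V" using uv e assms(2) by blast
  ultimately show ?case using W uv e(1) \<open>finite W\<close>
    by (intro exI[of _ "insert v W"] exI[of _ "insert e F'"]) auto
qed

text \<open>
  Growing inside \<open>T\<close> until all vertices are reached gives a connecting subset with \<open>card V - 1\<close> edges,
  which by minimality is \<open>T\<close>.
\<close>

lemma card_spanning_tree_edges:
  assumes T: "T \<in> spanning_tree_edges V E" and E: "\<forall>e \<in> E. e \<subseteq> V \<and> card e = 2"
    and V: "finite V" "V \<noteq> {}"
  shows "card T = card V - 1"
proof -
  have T': "T \<subseteq> E" "connects T V" "\<forall>e \<in> T. \<not> connects (T - {e}) V"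
    using T by (auto simp: spanning_tree_edges_def)
  have "card V > 0" using V by (simp add: card_gt_0_iff)
  then have k: "Suc (card V - 1) = card V" by simp
  have "\<forall>e \<in> T. e \<subseteq> V \<and> card e = 2" using T'(1) E by auto
  then obtain W F where W: "W \<subseteq> V" "card W = card V" "F \<subseteq> T" "card F = card V - 1" "connects F W"
    using connecting_subset_of_size[of T V "card V - 1", OF T'(2) _ V(1)] unfolding k by blast
  have "W = V" using W V card_subset_eq by blast
  have "F = T"
  proof (rule ccontr)
    assume "F \<noteq> T"
    then obtain e where e: "e \<in> T" "F \<subseteq> T - {e}" using W(3) by blast
    then have "connects (T - {e}) V"
      using W(5) uncut_mono[OF _ e(2)] \<open>W = V\<close> by (simp add: connects_def)
    then show False using T' e by blast
  qed
  then show ?thesis using W by simp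
qed

section \<open>Attaching a path to every edge\<close>

locale polygon_paths =
  fixes V :: "'a set" and E :: "'a set set" and n :: nat and P :: "'a set \<Rightarrow> 'a list"
  assumes edge: "e \<in> E \<Longrightarrow> e \<subseteq> V \<and> card e = 2"
    and finite_V: "finite V"
    and n: "n \<ge> 2"
    and path: "e \<in> E \<Longrightarrow> length (P e) = n + 1 \<and> distinct (P e) \<and> {hd (P e), last (P e)} = e \<and>
        inner_verts (P e) \<inter> V = {}"
    and disjoint: "e \<in> E \<Longrightarrow> f \<in> E \<Longrightarrow> e \<noteq> f \<Longrightarrow> inner_verts (P e) \<inter> inner_verts (P f) = {}"
begin

definition V' :: "'a set" where "V' = V \<union> (\<Union>e \<in> E. inner_verts (P e))"

definition E' :: "'a set set" where "E' = E \<union> (\<Union>e \<in> E. path_edges (P e))"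

definition seg :: "'a set \<Rightarrow> nat \<Rightarrow> 'a set" where "seg e k = {P e ! k, P e ! Suc k}"

definition missing :: "'a set set \<Rightarrow> 'a set \<Rightarrow> nat set" where
  "missing F e = {k. k < n \<and> seg e k \<notin> F}"

text \<open>
  The edges of \<open>E\<close> whose ends are joined by \<open>F\<close> within their own cycle.
\<close>

definition shadow :: "'a set set \<Rightarrow> 'a set set" where
  "shadow F = {e \<in> E. e \<in> F \<or> missing F e = {}}"

text \<open>
  One edge of each cycle is deleted: the path edge with index \<open>c e\<close>, where the index \<open>n\<close> stands for \<open>e\<close>
  itself. Moreover every edge outside \<open>T\<close> is deleted; for these, \<open>c e\<close> should be less than \<open>n\<close>.
\<close>

definition cut_open :: "'a set set \<Rightarrow> ('a set \<Rightarrow> nat) \<Rightarrow> 'a set set" where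
  "cut_open T c = {e \<in> T. c e \<noteq> n} \<union> {seg e k | e k. e \<in> E \<and> k < n \<and> k \<noteq> c e}"

lemma finite_E: "finite E"
proof -
  have "E \<subseteq> Pow V" using edge by blast
  then show ?thesis using finite_V by (meson finite_Pow_iff finite_subset)
qed

lemma ends: assumes "e \<in> E" shows "e = {P e ! 0, P e ! n}"
proof -
  have "P e \<noteq> []" "length (P e) - 1 = n" using path[OF assms] by auto
  then have "hd (P e) = P e ! 0" "last (P e) = P e ! n" by (auto simp: hd_conv_nth last_conv_nth)
  then show ?thesis using path[OF assms] by simp
qed

lemma ends_in_V: assumes "e \<in> E" shows "P e ! 0 \<in> V" "P e ! n \<in> V"
  using ends[OF assms] edge[OF assms] by auto

lemma inner_verts_eq: assumes "e \<in> E" shows "inner_verts (P e) = (!) (P e) ` {0<..<n}"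
proof -
  have l: "length (butlast (tl (P e))) = n - 1" using path[OF assms] by simp
  have nth: "butlast (tl (P e)) ! i = P e ! Suc i" if "i < n - 1" for i
    using that path[OF assms] by (simp add: nth_butlast nth_tl)
  have "inner_verts (P e) = (\<lambda>i. P e ! Suc i) ` {..<n - 1}"
    unfolding inner_verts_def set_conv_nth l using nth by (auto simp: image_def) metis
  also have "\<dots> = (!) (P e) ` (Suc ` {..<n - 1})" by (simp add: image_image)
  also have "Suc ` {..<n - 1} = {0<..<n}"
    unfolding image_Suc_lessThan using n by auto
  finally show ?thesis .
qed

lemma path_edges_eq: assumes "e \<in> E" shows "path_edges (P e) = seg e ` {..<n}"
  using path[OF assms] by (auto simp: path_edges_def seg_def)

lemma nth_in_inner_verts: "e \<in> E \<Longrightarrow> 0 < k \<Longrightarrow> k < n \<Longrightarrow> P e ! k \<in> inner_verts (P e)"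
  by (simp add: inner_verts_eq)

lemma inner_notin_V: "e \<in> E \<Longrightarrow> 0 < k \<Longrightarrow> k < n \<Longrightarrow> P e ! k \<notin> V"
  using path[of e] nth_in_inner_verts[of e k] by blast

lemma nth_eq_iff: "e \<in> E \<Longrightarrow> k \<le> n \<Longrightarrow> l \<le> n \<Longrightarrow> P e ! k = P e ! l \<longleftrightarrow> k = l"
  using path[of e] by (simp add: nth_eq_iff_index_eq)

lemma inner_eqD:
  assumes "e \<in> E" "f \<in> E" "0 < k" "k < n" "l \<le> n" "P e ! k = P f ! l"
  shows "e = f \<and> k = l"
proof -
  have "l \<noteq> 0" "l \<noteq> n" using inner_notin_V[of e k] ends_in_V[of f] assms by metis+
  then have "P e ! k \<in> inner_verts (P e) \<inter> inner_verts (P f)"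
    using assms nth_in_inner_verts[of e k] nth_in_inner_verts[of f l] by auto
  then have "e = f" using disjoint assms by blast
  then show ?thesis using assms nth_eq_iff by auto
qed

lemma seg_inner: assumes "e \<in> E" "k < n" obtains i where "0 < i" "i < n" "P e ! i \<in> seg e k"
proof (cases "k = 0")
  case True
  then show ?thesis using that[of 1] n by (simp add: seg_def)
next
  case False
  then show ?thesis using that[of k] assms by (simp add: seg_def)
qed

lemma seg_notin_E: assumes "e \<in> E" "k < n" shows "seg e k \<notin> E"
  using seg_inner[OF assms] inner_notin_V[OF assms(1)] edge by (metis in_mono)

lemma seg_eqD:
  assumes "e \<in> E" "f \<in> E" "k < n" "l < n" "seg e k = seg f l"
  shows "e = f \<and> k = l"
proof -
  obtain i where i: "0 < i" "i < n" "P e ! i \<in> seg e k" using seg_inner assms by blast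
  then have "P e ! i = P f ! l \<or> P e ! i = P f ! Suc l" using assms(5) by (auto simp: seg_def)
  moreover have "l \<le> n" "Suc l \<le> n" using assms(4) by auto
  ultimately have "e = f" using inner_eqD[OF assms(1,2) i(1,2)] by blast
  moreover have "k = l"
    using assms(3-5) nth_eq_iff[OF assms(1)] \<open>e = f\<close>
    by (auto simp: seg_def doubleton_eq_iff)
  ultimately show ?thesis ..
qed

lemma E'_eq: "E' = E \<union> {seg e k | e k. e \<in> E \<and> k < n}"
  unfolding E'_def using path_edges_eq by auto

lemma V'_eq: "V' = V \<union> {P e ! k | e k. e \<in> E \<and> k \<le> n}"
proof -
  have "P e ! k \<in> V \<union> inner_verts (P e)" if "e \<in> E" "k \<le> n" for e k
    using that inner_verts_eq[of e] ends_in_V[of e] by (cases "k = 0 \<or> k = n") auto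
  then show ?thesis unfolding V'_def using inner_verts_eq by fastforce
qed

lemma card_V': "card V' = card V + (n - 1) * card E"
proof -
  have "card (inner_verts (P e)) = n - 1" if "e \<in> E" for e
    unfolding inner_verts_eq[OF that]
    by (subst card_image) (auto simp: inj_on_def nth_eq_iff that)
  then have "card (\<Union>e \<in> E. inner_verts (P e)) = (n - 1) * card E"
    using finite_E disjoint by (subst card_UN_disjoint) (auto simp: inner_verts_def)
  moreover have "V \<inter> (\<Union>e \<in> E. inner_verts (P e)) = {}" using path by blast
  moreover have "finite (\<Union>e \<in> E. inner_verts (P e))" using finite_E by (auto simp: inner_verts_def)
  ultimately show ?thesis unfolding V'_def using finite_V by (simp add: card_Un_disjoint)
qed

lemma card_E': "card E' = (n + 1) * card E"
proof -
  have eq: "{seg e k | e k. e \<in> E \<and> k < n} = (\<lambda>(e, k). seg e k) ` (E \<times> {..<n})" by auto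
  have "card {seg e k | e k. e \<in> E \<and> k < n} = n * card E"
    unfolding eq by (subst card_image) (auto simp: inj_on_def card_cartesian_product dest: seg_eqD)
  moreover have "E \<inter> {seg e k | e k. e \<in> E \<and> k < n} = {}" using seg_notin_E by blast
  moreover have "finite {seg e k | e k. e \<in> E \<and> k < n}" unfolding eq using finite_E by simp
  ultimately show ?thesis unfolding E'_eq using finite_E by (simp add: card_Un_disjoint)
qed

text \<open>
  The cut condition read off along the paths, in the form in which all later arguments use it.
\<close>

lemma uncut_iff:
  assumes "F \<subseteq> E'"
  shows "uncut S F \<longleftrightarrow> (\<forall>e \<in> E. e \<in> F \<longrightarrow> (P e ! 0 \<in> S \<longleftrightarrow> P e ! n \<in> S)) \<and>
    (\<forall>e \<in> E. \<forall>k<n. k \<notin> missing F e \<longrightarrow> (P e ! k \<in> S \<longleftrightarrow> P e ! Suc k \<in> S))"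
    (is "_ \<longleftrightarrow> ?R")
proof
  assume S: "uncut S F"
  show ?R
  proof (intro conjI ballI allI impI)
    fix e assume "e \<in> E" "e \<in> F"
    then show "P e ! 0 \<in> S \<longleftrightarrow> P e ! n \<in> S" using uncut_pair[OF S] ends by metis
  next
    fix e k assume "e \<in> E" "k < n" "k \<notin> missing F e"
    then show "P e ! k \<in> S \<longleftrightarrow> P e ! Suc k \<in> S"
      using uncut_pair[OF S] by (auto simp: missing_def seg_def)
  qed
next
  assume R: ?R
  show "uncut S F"
    unfolding uncut_def
  proof
    fix x assume x: "x \<in> F"
    then consider "x \<in> E" | e k where "e \<in> E" "k < n" "x = seg e k" using assms E'_eq by auto
    then show "x \<subseteq> S \<or> x \<inter> S = {}"
    proof cases
      case 1
      then have "P x ! 0 \<in> S \<longleftrightarrow> P x ! n \<in> S" using R x by blast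
      then have "{P x ! 0, P x ! n} \<subseteq> S \<or> {P x ! 0, P x ! n} \<inter> S = {}" by blast
      then show ?thesis using ends[OF 1] by simp
    next
      case 2
      then have "P e ! k \<in> S \<longleftrightarrow> P e ! Suc k \<in> S" using R x by (auto simp: missing_def)
      then show ?thesis using 2 by (auto simp: seg_def)
    qed
  qed
qed

text \<open>
  A vertex set of \<open>H\<close> may be prescribed freely on \<open>V\<close> and along each path, as long as the
  prescriptions agree at the ends of the paths. This builds the cuts of \<open>H\<close> below.
\<close>

lemma vertex_set_with_sides:
  assumes "\<And>e. e \<in> E \<Longrightarrow> (Q e 0 \<longleftrightarrow> P e ! 0 \<in> A) \<and> (Q e n \<longleftrightarrow> P e ! n \<in> A)"
  obtains S where "S \<inter> V = A \<inter> V" "\<And>e k. e \<in> E \<Longrightarrow> k \<le> n \<Longrightarrow> P e ! k \<in> S \<longleftrightarrow> Q e k"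
proof
  let ?S = "(A \<inter> V) \<union> {P e ! k | e k. e \<in> E \<and> 0 < k \<and> k < n \<and> Q e k}"
  show "?S \<inter> V = A \<inter> V" using inner_notin_V by blast
  show "P e ! k \<in> ?S \<longleftrightarrow> Q e k" if e: "e \<in> E" "k \<le> n" for e k
  proof (cases "k = 0 \<or> k = n")
    case True
    then have "P e ! k \<in> V" using ends_in_V e by auto
    then have "P e ! k \<in> ?S \<longleftrightarrow> P e ! k \<in> A" by clarsimp (metis inner_notin_V)
    then show ?thesis using True assms[OF e(1)] by auto
  next
    case False
    then have k: "0 < k" "k < n" using e by auto
    show ?thesis
    proof
      assume "P e ! k \<in> ?S"
      then obtain f l where "f \<in> E" "0 < l" "l < n" "Q f l" "P e ! k = P f ! l"
        using inner_notin_V[OF e(1) k] by auto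
      then show "Q e k" using inner_eqD[of e f k l] e k by auto
    qed (use e k in blast)
  qed
qed

text \<open>
  If the path edges \<open>k < l\<close> are both absent, then the path vertices \<open>k + 1, \<dots>, l\<close> are cut off from
  the rest.
\<close>

lemma connects_missing_unique:
  assumes F: "F \<subseteq> E'" and conn: "connects F V'" and e: "e \<in> E"
    and kl: "k \<in> missing F e" "l \<in> missing F e" "k < l"
  shows False
proof -
  have l: "l < n" using kl by (simp add: missing_def)
  obtain S where S: "\<And>f i. f \<in> E \<Longrightarrow> i \<le> n \<Longrightarrow> P f ! i \<in> S \<longleftrightarrow> f = e \<and> k < i \<and> i \<le> l"
    by (rule vertex_set_with_sides[of "\<lambda>f i. f = e \<and> k < i \<and> i \<le> l" "{}"]) (use l in auto)
  have "uncut S F"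
    unfolding uncut_iff[OF F]
  proof (intro conjI ballI allI impI)
    fix f assume "f \<in> E"
    then show "P f ! 0 \<in> S \<longleftrightarrow> P f ! n \<in> S" using S l by simp
  next
    fix f i assume f: "f \<in> E" "i < n" "i \<notin> missing F f"
    then have "f = e \<Longrightarrow> i \<noteq> k \<and> i \<noteq> l" using kl by auto
    then show "P f ! i \<in> S \<longleftrightarrow> P f ! Suc i \<in> S" using S(1)[OF f(1)] f(2) by auto
  qed
  moreover have "P e ! 0 \<in> V'" "P e ! l \<in> V'" using e l less_imp_le unfolding V'_eq by blast+
  ultimately have "P e ! 0 \<in> S \<longleftrightarrow> P e ! l \<in> S" using connectsD[OF conn] by blast
  then show False using S(1)[OF e] l kl by simp
qed

text \<open>
  A vertex set \<open>A\<close> that the shadow does not cross extends to one that \<open>F\<close> does not cross: on a path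
  whose ends lie on different sides of \<open>A\<close> some edge is absent, and the change of side is placed there.
\<close>

lemma connects_shadow:
  assumes F: "F \<subseteq> E'" and conn: "connects F V'"
  shows "connects (shadow F) V"
  unfolding connects_def
proof (intro allI impI)
  fix A assume A: "uncut A (shadow F)"
  have ends_eq: "P e ! 0 \<in> A \<longleftrightarrow> P e ! n \<in> A" if "e \<in> shadow F" for e
    using uncut_pair[OF A] ends that by (metis (no_types, lifting) mem_Collect_eq shadow_def)
  have "\<exists>q. (q 0 \<longleftrightarrow> P e ! 0 \<in> A) \<and> (q n \<longleftrightarrow> P e ! n \<in> A) \<and>
    (\<forall>k<n. k \<notin> missing F e \<longrightarrow> (q k \<longleftrightarrow> q (Suc k)))" if e: "e \<in> E" for e
  proof (cases "missing F e = {}")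
    case True
    then have "P e ! 0 \<in> A \<longleftrightarrow> P e ! n \<in> A" using e ends_eq by (simp add: shadow_def)
    then show ?thesis by (intro exI[of _ "\<lambda>_. P e ! 0 \<in> A"]) auto
  next
    case False
    then obtain m where m: "m \<in> missing F e" by blast
    then have "m < n" by (simp add: missing_def)
    then show ?thesis using m
      by (intro exI[of _ "\<lambda>k. if k \<le> m then P e ! 0 \<in> A else P e ! n \<in> A"])
        (auto simp: Suc_le_eq le_less)
  qed
  then obtain Q where Q: "\<And>e. e \<in> E \<Longrightarrow> (Q e 0 \<longleftrightarrow> P e ! 0 \<in> A) \<and> (Q e n \<longleftrightarrow> P e ! n \<in> A) \<and>
    (\<forall>k<n. k \<notin> missing F e \<longrightarrow> (Q e k \<longleftrightarrow> Q e (Suc k)))"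
    by metis
  then obtain S where S: "S \<inter> V = A \<inter> V" "\<And>e k. e \<in> E \<Longrightarrow> k \<le> n \<Longrightarrow> P e ! k \<in> S \<longleftrightarrow> Q e k"
    using vertex_set_with_sides[of Q A] by metis
  have "uncut S F"
    unfolding uncut_iff[OF F]
  proof (intro conjI ballI allI impI)
    fix e assume e: "e \<in> E" "e \<in> F"
    then have "e \<in> shadow F" by (simp add: shadow_def)
    then show "P e ! 0 \<in> S \<longleftrightarrow> P e ! n \<in> S" using S(2)[OF e(1)] Q[OF e(1)] ends_eq by simp
  next
    fix e k assume "e \<in> E" "k < n" "k \<notin> missing F e"
    then show "P e ! k \<in> S \<longleftrightarrow> P e ! Suc k \<in> S" using S(2)[of e] Q[of e] by simp
  qed
  then have "V' \<subseteq> S \<or> V' \<inter> S = {}" using conn by (simp add: connects_def)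
  then show "V \<subseteq> A \<or> V \<inter> A = {}" using S(1) unfolding V'_def by blast
qed

text \<open>
  Edges of the shadow have both ends on the same side of any cut of \<open>H\<close>, so \<open>V\<close> lies on one side.
  With at most one edge of the path absent, every inner vertex is still linked to an end of its path.
\<close>

lemma connects_if_connects_shadow:
  assumes F: "F \<subseteq> E'" and conn: "connects (shadow F) V"
    and missing: "\<And>e k l. e \<in> E \<Longrightarrow> k \<in> missing F e \<Longrightarrow> l \<in> missing F e \<Longrightarrow> k = l"
  shows "connects F V'"
  unfolding connects_def
proof (intro allI impI)
  fix S assume S: "uncut S F"
  have run: "P e ! i \<in> S \<longleftrightarrow> P e ! j \<in> S"
    if e: "e \<in> E" and ij: "i \<le> j" "j \<le> n" "\<And>k. i \<le> k \<Longrightarrow> k < j \<Longrightarrow> k \<notin> missing F e" for e i j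
    using ij
  proof (induction j rule: dec_induct)
    case (step j)
    then have "j < n" "j \<notin> missing F e" by auto
    then have "P e ! j \<in> S \<longleftrightarrow> P e ! Suc j \<in> S" using S e unfolding uncut_iff[OF F] by blast
    then show ?case using step by auto
  qed simp
  have "uncut S (shadow F)"
    unfolding uncut_def
  proof
    fix e assume e: "e \<in> shadow F"
    then have eE: "e \<in> E" by (simp add: shadow_def)
    have "P e ! 0 \<in> S \<longleftrightarrow> P e ! n \<in> S"
    proof (cases "e \<in> F")
      case True
      then show ?thesis using S eE unfolding uncut_iff[OF F] by blast
    next
      case False
      then show ?thesis using e run[OF eE, of 0 n] by (simp add: shadow_def)
    qed
    then have "{P e ! 0, P e ! n} \<subseteq> S \<or> {P e ! 0, P e ! n} \<inter> S = {}" by blast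
    then show "e \<subseteq> S \<or> e \<inter> S = {}" using ends[OF eE] by simp
  qed
  then have V: "V \<subseteq> S \<or> V \<inter> S = {}" using conn by (simp add: connects_def)
  have to_end: "(P e ! k \<in> S \<longleftrightarrow> P e ! 0 \<in> S) \<or> (P e ! k \<in> S \<longleftrightarrow> P e ! n \<in> S)"
    if e: "e \<in> E" "k \<le> n" for e k
  proof (cases "\<exists>m \<in> missing F e. m < k")
    case True
    then have "j \<notin> missing F e" if "k \<le> j" for j
      using missing[OF e(1)] that by (metis leD)
    then show ?thesis using run[OF e] by auto
  next
    case False
    then show ?thesis using run[OF e(1), of 0 k] e by auto
  qed
  show "V' \<subseteq> S \<or> V' \<inter> S = {}"
    using V
  proof
    assume V: "V \<subseteq> S"
    then have "P e ! k \<in> S" if "e \<in> E" "k \<le> n" for e k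
      using to_end[OF that] ends_in_V[OF that(1)] by auto
    then show ?thesis using V V'_eq by auto
  next
    assume V: "V \<inter> S = {}"
    then have "P e ! k \<notin> S" if "e \<in> E" "k \<le> n" for e k
      using to_end[OF that] ends_in_V[OF that(1)] by auto
    then show ?thesis using V V'_eq by auto
  qed
qed

lemma connects_iff:
  assumes "F \<subseteq> E'"
  shows "connects F V' \<longleftrightarrow> connects (shadow F) V \<and>
    (\<forall>e \<in> E. \<forall>k \<in> missing F e. \<forall>l \<in> missing F e. k = l)"
  using connects_missing_unique[OF assms] connects_shadow[OF assms]
    connects_if_connects_shadow[OF assms] by (metis linorder_neqE_nat)

lemma missing_delete_edge: "e \<in> E \<Longrightarrow> f \<in> E \<Longrightarrow> missing (F - {f}) e = missing F e"
  using seg_notin_E by (auto simp: missing_def)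

lemma missing_delete_seg:
  "e \<in> E \<Longrightarrow> f \<in> E \<Longrightarrow> k < n \<Longrightarrow>
    missing (F - {seg f k}) e = (if e = f then insert k (missing F e) else missing F e)"
  using seg_eqD[of e f _ k] by (auto simp: missing_def)

lemma shadow_delete_edge:
  "f \<in> E \<Longrightarrow> missing F f \<noteq> {} \<Longrightarrow> shadow (F - {f}) = shadow F - {f}"
  using missing_delete_edge by (auto simp: shadow_def)

lemma shadow_delete_seg:
  "f \<in> E \<Longrightarrow> k < n \<Longrightarrow> f \<notin> F \<Longrightarrow> shadow (F - {seg f k}) = shadow F - {f}"
  using missing_delete_seg seg_notin_E by (auto simp: shadow_def split: if_splits)

text \<open>
  Compatibility of minimality with the shadow. Provided no cycle is complete, deleting an edge of \<open>F\<close>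
  either leaves two path edges absent from one path or removes exactly one edge from the shadow; and
  every edge of the shadow can be removed in this way. In a complete cycle, in contrast, \<open>e\<close> is redundant.
\<close>

lemma spanning_tree_edges_iff:
  assumes F: "F \<subseteq> E'"
  shows "F \<in> spanning_tree_edges V' E' \<longleftrightarrow> shadow F \<in> spanning_tree_edges V E \<and>
    (\<forall>e \<in> E. \<forall>k \<in> missing F e. \<forall>l \<in> missing F e. k = l) \<and>
    (\<forall>e \<in> E. e \<in> F \<longrightarrow> missing F e \<noteq> {})"
    (is "?L \<longleftrightarrow> ?T \<and> ?U \<and> ?N")
proof
  assume ?L
  then have conn: "connects F V'" and min: "\<And>x. x \<in> F \<Longrightarrow> \<not> connects (F - {x}) V'"
    by (auto simp: spanning_tree_edges_def)
  have sh: "connects (shadow F) V" and U: ?U using conn connects_iff[OF F] by auto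
  have sub: "F - {x} \<subseteq> E'" for x using F by blast
  have N: ?N
  proof (intro ballI impI)
    fix e assume e: "e \<in> E" "e \<in> F"
    show "missing F e \<noteq> {}"
    proof
      assume "missing F e = {}"
      then have "shadow (F - {e}) = shadow F"
        using e missing_delete_edge[OF _ e(1)] by (auto simp: shadow_def)
      then show False
        using min[OF e(2)] sh U missing_delete_edge[OF _ e(1)] connects_iff[OF sub] by auto
    qed
  qed
  have "\<not> connects (shadow F - {e}) V" if e: "e \<in> shadow F" for e
  proof
    assume c: "connects (shadow F - {e}) V"
    have eE: "e \<in> E" using e by (simp add: shadow_def)
    show False
    proof (cases "e \<in> F")
      case True
      then have "shadow (F - {e}) = shadow F - {e}" using shadow_delete_edge eE N by blast
      then show False
        using min[OF True] c U missing_delete_edge[OF _ eE] connects_iff[OF sub] by auto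
    next
      case False
      then have m: "missing F e = {}" using e by (simp add: shadow_def)
      then have "seg e 0 \<in> F" using n by (auto simp: missing_def)
      moreover have "shadow (F - {seg e 0}) = shadow F - {e}"
        using shadow_delete_seg eE False n by simp
      moreover have "k = l"
        if d: "d \<in> E" and kl: "k \<in> missing (F - {seg e 0}) d" "l \<in> missing (F - {seg e 0}) d" for d k l
      proof (cases "d = e")
        case True
        then show ?thesis using kl missing_delete_seg[OF eE eE, of 0 F] m n by simp
      next
        case False
        then have "missing (F - {seg e 0}) d = missing F d"
          using missing_delete_seg[OF d eE, of 0 F] n by simp
        then show ?thesis using U d kl by simp
      qed
      ultimately show False
        using min[of "seg e 0"] c connects_if_connects_shadow[OF sub] by metis
    qed
  qed
  then have ?T using sh by (auto simp: spanning_tree_edges_def shadow_def)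
  with U N show "?T \<and> ?U \<and> ?N" by blast
next
  assume R: "?T \<and> ?U \<and> ?N"
  then have U: ?U and N: ?N and sh: "connects (shadow F) V"
    and min: "\<And>e. e \<in> shadow F \<Longrightarrow> \<not> connects (shadow F - {e}) V"
    by (auto simp: spanning_tree_edges_def)
  have sub: "F - {x} \<subseteq> E'" for x using F by blast
  have "\<not> connects (F - {x}) V'" if x: "x \<in> F" for x
  proof -
    consider "x \<in> E" | e k where "e \<in> E" "k < n" "x = seg e k" using x F E'_eq by auto
    then show ?thesis
    proof cases
      case 1
      then have "shadow (F - {x}) = shadow F - {x}" using x N shadow_delete_edge by blast
      moreover have "x \<in> shadow F" using 1 x by (simp add: shadow_def)
      ultimately show ?thesis using min connects_iff[OF sub] by auto
    next
      case 2
      \<comment> \<open>Deleting a path edge opens a complete path, which removes \<open>e\<close> from the shadow, or creates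
        a second gap.\<close>
      have k: "k \<notin> missing F e" using 2 x by (simp add: missing_def)
      show ?thesis
      proof (cases "missing F e = {}")
        case True
        then have "shadow (F - {x}) = shadow F - {e}" using 2 N shadow_delete_seg by blast
        moreover have "e \<in> shadow F" using 2 True by (simp add: shadow_def)
        ultimately show ?thesis using min connects_iff[OF sub] by auto
      next
        case False
        then obtain m where "m \<in> missing F e" by blast
        then have "m \<in> missing (F - {x}) e" "k \<in> missing (F - {x}) e" "m \<noteq> k"
          using 2 k missing_delete_seg[of e e k F] by auto
        then show ?thesis using 2 connects_iff[OF sub] by blast
      qed
    qed
  qed
  then show ?L using F sh U connects_iff[OF F] by (auto simp: spanning_tree_edges_def)
qed

section \<open>Counting by independent choices in the cycles\<close>

definition choices :: "'a set set \<Rightarrow> ('a set \<Rightarrow> nat) set" where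
  "choices T = (\<Pi>\<^sub>E e \<in> E. if e \<in> T then {..n} else {..<n})"

lemma choicesD:
  assumes "c \<in> choices T" "e \<in> E"
  shows "c e \<le> n" "c e = n \<Longrightarrow> e \<in> T"
  using PiE_mem[OF assms[unfolded choices_def]] by (auto split: if_splits)

lemma card_choices:
  assumes "T \<subseteq> E"
  shows "card (choices T) = (n + 1) ^ card T * n ^ (card E - card T)"
proof -
  have "card (choices T) = (\<Prod>e \<in> E. if e \<in> T then n + 1 else n)"
    unfolding choices_def using finite_E by (subst card_PiE) (auto intro!: prod.cong)
  also have "\<dots> = (\<Prod>e \<in> E \<inter> {e. e \<in> T}. n + 1) * (\<Prod>e \<in> E \<inter> - {e. e \<in> T}. n)"
    by (rule prod.If_cases[OF finite_E])
  also have "\<dots> = (\<Prod>e \<in> E \<inter> T. n + 1) * (\<Prod>e \<in> E - T. n)" by (simp add: Diff_eq)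
  also have "E \<inter> T = T" using assms by blast
  also have "card (E - T) = card E - card T"
    using assms finite_E by (simp add: card_Diff_subset finite_subset)
  then have "(\<Prod>e \<in> T. n + 1) * (\<Prod>e \<in> E - T. n) = (n + 1) ^ card T * n ^ (card E - card T)"
    by simp
  finally show ?thesis .
qed

lemma cut_open_subset: "T \<subseteq> E \<Longrightarrow> cut_open T c \<subseteq> E'"
  unfolding cut_open_def E'_eq by blast

lemma edge_in_cut_open_iff: "e \<in> E \<Longrightarrow> e \<in> cut_open T c \<longleftrightarrow> e \<in> T \<and> c e \<noteq> n"
  unfolding cut_open_def using seg_notin_E by auto

lemma seg_in_cut_open_iff:
  "T \<subseteq> E \<Longrightarrow> e \<in> E \<Longrightarrow> k < n \<Longrightarrow> seg e k \<in> cut_open T c \<longleftrightarrow> k \<noteq> c e"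
  unfolding cut_open_def using seg_notin_E seg_eqD by blast

lemma missing_cut_open:
  "T \<subseteq> E \<Longrightarrow> e \<in> E \<Longrightarrow> missing (cut_open T c) e = {c e} \<inter> {..<n}"
  by (auto simp: missing_def seg_in_cut_open_iff)

lemma shadow_cut_open:
  assumes "T \<subseteq> E" "c \<in> choices T"
  shows "shadow (cut_open T c) = T"
proof -
  have "e \<in> shadow (cut_open T c) \<longleftrightarrow> e \<in> T" if e: "e \<in> E" for e
  proof -
    have "{c e} \<inter> {..<n} = {} \<longleftrightarrow> c e = n" using choicesD(1)[OF assms(2) e] by auto
    then show ?thesis
      using e choicesD(2)[OF assms(2) e]
      by (auto simp: shadow_def edge_in_cut_open_iff missing_cut_open[OF assms(1)])
  qed
  then show ?thesis using assms(1) by (auto simp: shadow_def)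
qed

lemma cut_open_in_spanning_tree_edges:
  assumes "T \<in> spanning_tree_edges V E" "c \<in> choices T"
  shows "cut_open T c \<in> spanning_tree_edges V' E'"
proof -
  have T: "T \<subseteq> E" using assms by (simp add: spanning_tree_edges_def)
  have "missing (cut_open T c) e \<noteq> {}" if e: "e \<in> E" "e \<in> cut_open T c" for e
  proof -
    have "c e < n" using e edge_in_cut_open_iff[OF e(1)] choicesD(1)[OF assms(2) e(1)] by auto
    then show ?thesis using missing_cut_open[OF T e(1)] by auto
  qed
  moreover have "k = l" if "e \<in> E" "k \<in> missing (cut_open T c) e" "l \<in> missing (cut_open T c) e"
    for e k l using that missing_cut_open[OF T] by auto
  ultimately show ?thesis
    using assms(1) shadow_cut_open[OF T assms(2)]
    unfolding spanning_tree_edges_iff[OF cut_open_subset[OF T]] by simp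
qed

text \<open>
  The tree is recovered as the shadow, and the option at \<open>e\<close> as the index of the absent path edge, or
  \<open>n\<close> if the path is complete.
\<close>

lemma cut_open_inj:
  assumes T: "T1 \<subseteq> E" "T2 \<subseteq> E" and c: "c1 \<in> choices T1" "c2 \<in> choices T2"
    and eq: "cut_open T1 c1 = cut_open T2 c2"
  shows "T1 = T2 \<and> c1 = c2"
proof
  show "T1 = T2" using shadow_cut_open T c eq by metis
  have "c1 e = c2 e" if e: "e \<in> E" for e
  proof -
    have "{c1 e} \<inter> {..<n} = {c2 e} \<inter> {..<n}" using missing_cut_open T eq e by metis
    moreover have "c1 e \<le> n" "c2 e \<le> n" using choicesD c e by auto
    ultimately show ?thesis by (cases "c1 e < n"; cases "c2 e < n") auto
  qed
  moreover have "c1 \<in> extensional E" "c2 \<in> extensional E"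
    using c by (auto simp: choices_def PiE_def)
  ultimately show "c1 = c2" by (metis extensionalityI)
qed

lemma cut_open_surj:
  assumes F: "F \<in> spanning_tree_edges V' E'"
  shows "\<exists>T \<in> spanning_tree_edges V E. \<exists>c \<in> choices T. F = cut_open T c"
proof -
  have sub: "F \<subseteq> E'" using F by (simp add: spanning_tree_edges_def)
  note R = F[unfolded spanning_tree_edges_iff[OF sub]]
  define c where "c = (\<lambda>e \<in> E. if missing F e = {} then n else SOME k. k \<in> missing F e)"
  have c: "missing F e = {c e} \<inter> {..<n}" "c e \<le> n" "c e = n \<longleftrightarrow> missing F e = {}" if "e \<in> E" for e
  proof -
    have "missing F e = {c e} \<inter> {..<n} \<and> c e \<le> n \<and> (c e = n \<longleftrightarrow> missing F e = {})"
    proof (cases "missing F e = {}")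
      case True
      then show ?thesis using that by (simp add: c_def)
    next
      case False
      then have "c e \<in> missing F e" using that by (simp add: c_def some_in_eq)
      moreover from this have "c e < n" by (simp add: missing_def)
      ultimately show ?thesis using that R by auto
    qed
    then show "missing F e = {c e} \<inter> {..<n}" "c e \<le> n" "c e = n \<longleftrightarrow> missing F e = {}" by auto
  qed
  have ch: "c \<in> choices (shadow F)"
    unfolding choices_def
  proof (rule PiE_I)
    fix e assume e: "e \<in> E"
    show "c e \<in> (if e \<in> shadow F then {..n} else {..<n})"
      using c[OF e] e by (auto simp: shadow_def)
  qed (simp add: c_def)
  have sh: "shadow F \<subseteq> E" by (auto simp: shadow_def)
  have "x \<in> F \<longleftrightarrow> x \<in> cut_open (shadow F) c" if x: "x \<in> E'" for x
  proof -
    consider "x \<in> E" | e k where "e \<in> E" "k < n" "x = seg e k" using x E'_eq by auto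
    then show ?thesis
    proof cases
      case 1
      then show ?thesis using R c(3)[OF 1] by (auto simp: edge_in_cut_open_iff shadow_def)
    next
      case 2
      then have "x \<in> F \<longleftrightarrow> k \<notin> missing F e" by (simp add: missing_def)
      then show ?thesis using 2 c(1)[of e] seg_in_cut_open_iff[OF sh] by auto
    qed
  qed
  then have "F = cut_open (shadow F) c" using sub cut_open_subset[OF sh] by blast
  then show ?thesis using R ch by blast
qed

text \<open>
  The spanning trees of \<open>H\<close> correspond to the pairs of a spanning tree \<open>T\<close> and a family in \<open>choices T\<close>,
  and the number of such families is the same for all \<open>T\<close> since all \<open>T\<close> have the same size.
\<close>

lemma card_spanning_tree_edges_polygon:
  assumes ne: "V \<noteq> {}"
  shows "card (spanning_tree_edges V' E') =
    (n + 1) ^ (card V - 1) * n ^ (card E - (card V - 1)) * card (spanning_tree_edges V E)"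
proof -
  let ?S = "spanning_tree_edges V E"
  have sub: "T \<subseteq> E" if "T \<in> ?S" for T using that by (simp add: spanning_tree_edges_def)
  have fin: "finite ?S"
    using finite_E by (auto intro: finite_subset[of _ "Pow E"] simp: spanning_tree_edges_def)
  have "bij_betw (\<lambda>(T, c). cut_open T c) (Sigma ?S choices) (spanning_tree_edges V' E')"
  proof (rule bij_betw_imageI)
    show "inj_on (\<lambda>(T, c). cut_open T c) (Sigma ?S choices)"
      by (auto simp: inj_on_def dest: cut_open_inj[OF sub sub])
    show "(\<lambda>(T, c). cut_open T c) ` Sigma ?S choices = spanning_tree_edges V' E'"
      using cut_open_in_spanning_tree_edges cut_open_surj by force
  qed
  then have "card (spanning_tree_edges V' E') = card (Sigma ?S choices)"
    by (rule bij_betw_same_card[symmetric])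
  also have "\<dots> = (\<Sum>T \<in> ?S. card (choices T))"
    using fin finite_E by (subst card_SigmaI) (auto simp: choices_def intro!: finite_PiE)
  also have "\<dots> = (\<Sum>T \<in> ?S. (n + 1) ^ (card V - 1) * n ^ (card E - (card V - 1)))"
    using card_choices sub card_spanning_tree_edges[of _ V E] edge finite_V ne
    by (intro sum.cong) auto
  finally show ?thesis by (simp add: mult.commute)
qed

end

section \<open>Polygon graphs and their iteration\<close>

lemma polygon_graph_paths:
  assumes G: "simple_graph G" and n: "n \<ge> 2" and H: "polygon_graph n G H"
  obtains P where "polygon_paths (verts G) (edges G) n P"
    "verts H = polygon_paths.V' (verts G) (edges G) P"
    "edges H = polygon_paths.E' (edges G) P"
proof -
  obtain P where P:
    "\<forall>e \<in> edges G. length (P e) = n + 1 \<and> distinct (P e) \<and> {hd (P e), last (P e)} = e \<and>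
        inner_verts (P e) \<inter> verts G = {}"
    "\<forall>e \<in> edges G. \<forall>f \<in> edges G. e \<noteq> f \<longrightarrow> inner_verts (P e) \<inter> inner_verts (P f) = {}"
    and VE: "verts H = verts G \<union> (\<Union>e \<in> edges G. inner_verts (P e))"
     "edges H = edges G \<union> (\<Union>e \<in> edges G. path_edges (P e))"
    using H unfolding polygon_graph_def by auto
  interpret polygon_paths "verts G" "edges G" n P
    using P G n by unfold_locales (auto simp: simple_graph_def)
  show ?thesis using that[OF polygon_paths_axioms] VE V'_def E'_def by simp
qed

lemma polygon_graph_card:
  assumes "simple_graph G" "n \<ge> 2" "polygon_graph n G H"
  shows "card (verts H) = card (verts G) + (n - 1) * card (edges G)"
    and "card (edges H) = (n + 1) * card (edges G)"
proof -
  obtain P where P: "polygon_paths (verts G) (edges G) n P"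
    "verts H = polygon_paths.V' (verts G) (edges G) P"
    "edges H = polygon_paths.E' (edges G) P"
    using polygon_graph_paths[OF assms] .
  interpret polygon_paths "verts G" "edges G" n P by fact
  show "card (verts H) = card (verts G) + (n - 1) * card (edges G)"
    "card (edges H) = (n + 1) * card (edges G)"
    using P(2,3) card_V' card_E' by simp_all
qed

lemma polygon_graph_verts_nonempty: "polygon_graph n G H \<Longrightarrow> verts G \<noteq> {} \<Longrightarrow> verts H \<noteq> {}"
  by (auto simp: polygon_graph_def)

text \<open>
  If \<open>G\<close> has a spanning tree, then \<open>card (edges G) \<ge> card (verts G) - 1\<close>, so the real exponents are the
  natural ones of the counting formula; otherwise both sides vanish.
\<close>

lemma N_st_polygon_graph:
  assumes G: "simple_graph G" and ne: "verts G \<noteq> {}" and n: "n \<ge> 2" and H: "polygon_graph n G H"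
  shows "real (N_st H) = (real n + 1) powr (real (card (verts G)) - 1) *
    real n powr (real (card (edges G)) - real (card (verts G)) + 1) * real (N_st G)"
proof -
  let ?N = "card (verts G)" and ?E = "card (edges G)"
  let ?S = "spanning_tree_edges (verts G) (edges G)"
  obtain P where P: "polygon_paths (verts G) (edges G) n P"
    "verts H = polygon_paths.V' (verts G) (edges G) P"
    "edges H = polygon_paths.E' (edges G) P"
    using polygon_graph_paths[OF G n H] .
  interpret polygon_paths "verts G" "edges G" n P by fact
  have "N_st H = (n + 1) ^ (?N - 1) * n ^ (?E - (?N - 1)) * N_st G"
    using N_st_eq_card_spanning_tree_edges[OF G ne]
      N_st_eq_card_spanning_tree_edges[OF simple_graph_polygon_graph[OF G n H]
        polygon_graph_verts_nonempty[OF H ne]]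
      card_spanning_tree_edges_polygon[OF ne] P(2,3) by simp
  then have eq: "real (N_st H) =
      (real n + 1) ^ (?N - 1) * real n ^ (?E - (?N - 1)) * real (N_st G)"
    by (simp add: add.commute)
  show ?thesis
  proof (cases "?S = {}")
    case True
    then have "N_st G = 0" using N_st_eq_card_spanning_tree_edges[OF G ne] by simp
    then show ?thesis using eq by simp
  next
    case False
    then obtain T where T: "T \<in> ?S" by blast
    then have "card T = ?N - 1" using card_spanning_tree_edges edge finite_V ne by blast
    moreover have "card T \<le> ?E"
      using T finite_E by (auto simp: spanning_tree_edges_def intro: card_mono)
    moreover have "?N \<ge> 1" using finite_V ne by (simp add: Suc_le_eq card_gt_0_iff)
    ultimately have exps: "real ?N - 1 = real (?N - 1)"
      "real ?E - real ?N + 1 = real (?E - (?N - 1))"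
      by (auto simp: of_nat_diff)
    have "(real n + 1) powr (real ?N - 1) = (real n + 1) ^ (?N - 1)"
      "real n powr (real ?E - real ?N + 1) = real n ^ (?E - (?N - 1))"
      unfolding exps using n by (simp_all add: powr_realpow)
    then show ?thesis using eq by simp
  qed
qed

text \<open>
  The recursions of the two exponents, with \<open>q\<close> in the role of \<open>(n + 1)^g\<close>: the exponent after \<open>g\<close>
  generations at the parameters \<open>N + (n - 1) E\<close> and \<open>(n + 1) E\<close> of \<open>\<tau>\<^sub>n(G)\<close>, plus the exponent for the
  first generation, is the exponent after \<open>g + 1\<close> generations.
\<close>

lemma polygon_exponent_Suc1:
  fixes x q g N E :: real
  assumes "x > 0"
  shows "(x - 1) * (q - x * g - 1) / x\<^sup>2 * ((x + 1) * E) + g * (N + (x - 1) * E) - g + (N - 1) =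
    (x - 1) * ((x + 1) * q - x * (1 + g) - 1) / x\<^sup>2 * E + (1 + g) * N - (1 + g)"
proof -
  \<comment> \<open>Only the coefficients of \<open>E\<close> need to be compared; keeping them opaque here keeps the fractions
    out of the polynomial arithmetic.\<close>
  have regroup: "a * ((x + 1) * E) + g * (N + (x - 1) * E) - g + (N - 1) = b * E + (1 + g) * N - (1 + g)"
    if "b = a * (x + 1) + g * (x - 1)" for a b
    unfolding that by (simp add: algebra_simps)
  have "(x - 1) * ((x + 1) * q - x * (1 + g) - 1) =
    (x - 1) * (q - x * g - 1) * (x + 1) + g * (x - 1) * x\<^sup>2"
    by (simp add: algebra_simps power2_eq_square)
  then show ?thesis using assms by (intro regroup) (simp add: add_divide_distrib)
qed

lemma polygon_exponent_Suc2:
  fixes x q g N E :: real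
  assumes "x > 0"
  shows "(q + (x - 1) * x * g - 1) / x\<^sup>2 * ((x + 1) * E) - g * (N + (x - 1) * E) + g + (E - N + 1) =
    ((x + 1) * q + (x - 1) * x * (1 + g) - 1) / x\<^sup>2 * E - (1 + g) * N + (1 + g)"
proof -
  have regroup: "a * ((x + 1) * E) - g * (N + (x - 1) * E) + g + (E - N + 1) = b * E - (1 + g) * N + (1 + g)"
    if "b = a * (x + 1) + (1 - g * (x - 1))" for a b
    unfolding that by (simp add: algebra_simps)
  have "(x + 1) * q + (x - 1) * x * (1 + g) - 1 =
    (q + (x - 1) * x * g - 1) * (x + 1) + (1 - g * (x - 1)) * x\<^sup>2"
    by (simp add: algebra_simps power2_eq_square)
  then show ?thesis using assms by (intro regroup) (simp add: add_divide_distrib)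
qed

text \<open>
  The induction peels off the first generation: \<open>H\<close> arises in \<open>g\<close> generations from \<open>K = \<tau>\<^sub>n(G)\<close>, and the
  induction hypothesis is applied to \<open>K\<close>. The hypotheses on \<open>G\<close> are ones that \<open>K\<close> visibly inherits.
\<close>

lemma N_st_iterated_polygon_graph:
  assumes "simple_graph G" "verts G \<noteq> {}" "n \<ge> 2" "iterated_polygon_graph n g G H"
  shows "real (N_st H) =
    (real n + 1) powr
      ((real n - 1) * ((real n + 1) ^ g - real n * real g - 1) / (real n)\<^sup>2 * real (card (edges G))
        + real g * real (card (verts G)) - real g)
    * real n powr
      (((real n + 1) ^ g + (real n - 1) * real n * real g - 1) / (real n)\<^sup>2 * real (card (edges G))
        - real g * real (card (verts G)) + real g)
    * real (N_st G)"
  using assms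
proof (induction g arbitrary: G)
  case 0
  then show ?case by (simp add: iterated_polygon_graph_def)
next
  case (Suc g)
  obtain K where K: "polygon_graph n G K" "iterated_polygon_graph n g K H"
    using Suc.prems(4) unfolding iterated_polygon_graph_def by (meson relpowp_Suc_D2)
  have sK: "simple_graph K" using simple_graph_polygon_graph Suc.prems K by blast
  have neK: "verts K \<noteq> {}" using polygon_graph_verts_nonempty Suc.prems K by blast
  let ?N = "real (card (verts G))" and ?E = "real (card (edges G))" and ?x = "real n"
  have x: "?x > 0" using Suc.prems(3) by simp
  have card: "real (card (verts K)) = ?N + (?x - 1) * ?E" "real (card (edges K)) = (?x + 1) * ?E"
    unfolding polygon_graph_card[OF Suc.prems(1,3) K(1)] using Suc.prems(3)
    by (simp_all add: of_nat_diff distrib_right)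
  let ?a = "(?x - 1) * ((?x + 1) ^ g - ?x * real g - 1) / ?x\<^sup>2 * ((?x + 1) * ?E)
    + real g * (?N + (?x - 1) * ?E) - real g"
  let ?b = "((?x + 1) ^ g + (?x - 1) * ?x * real g - 1) / ?x\<^sup>2 * ((?x + 1) * ?E)
    - real g * (?N + (?x - 1) * ?E) + real g"
  have a: "?a + (?N - 1) = (?x - 1) * ((?x + 1) ^ Suc g - ?x * real (Suc g) - 1) / ?x\<^sup>2 * ?E
      + real (Suc g) * ?N - real (Suc g)"
    unfolding power_Suc of_nat_Suc by (rule polygon_exponent_Suc1[OF x])
  have b: "?b + (?E - ?N + 1) = ((?x + 1) ^ Suc g + (?x - 1) * ?x * real (Suc g) - 1) / ?x\<^sup>2 * ?E
      - real (Suc g) * ?N + real (Suc g)"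
    unfolding power_Suc of_nat_Suc by (rule polygon_exponent_Suc2[OF x])
  have "real (N_st H) = (?x + 1) powr ?a * ?x powr ?b * real (N_st K)"
    using Suc.IH[OF sK neK Suc.prems(3) K(2)] unfolding card .
  also have "\<dots> = (?x + 1) powr (?a + (?N - 1)) * ?x powr (?b + (?E - ?N + 1)) * real (N_st G)"
    unfolding N_st_polygon_graph[OF Suc.prems(1-3) K(1)] powr_add by (simp only: ac_simps)
  finally show ?case unfolding a b .
qed

theorem theorem5p3:
  fixes G :: "'a ugraph" and n N0 E0 :: nat
  assumes "simple_graph G"
    and "connected_graph G"
    and "N0 = card (verts G)"
    and "E0 = card (edges G)"
    and "n \<ge> 2"
  shows "(\<forall>H. polygon_graph n G H \<longrightarrow>
            real (N_st H) =
              (real n + 1) powr (real N0 - 1) * real n powr (real E0 - real N0 + 1) * real (N_st G))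
       \<and> (\<forall>g::nat. g \<ge> 1 \<longrightarrow> (\<forall>H. iterated_polygon_graph n g G H \<longrightarrow>
            real (N_st H) =
              (real n + 1) powr
                ((real n - 1) * ((real n + 1) ^ g - real n * real g - 1) / (real n)\<^sup>2 * real E0
                  + real g * real N0 - real g)
              * real n powr
                (((real n + 1) ^ g + (real n - 1) * real n * real g - 1) / (real n)\<^sup>2 * real E0
                  - real g * real N0 + real g)
              * real (N_st G)))"
proof -
  have "verts G \<noteq> {}" using assms(2) by (simp add: connected_graph_def)
  then show ?thesis
    using N_st_polygon_graph N_st_iterated_polygon_graph assms by blast
qed

end
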